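(* Let $N$ be the number of regions in the bottom layer, let $T$ be the number of time intervals, and suppose that every region has exactly $M$ children in the next lower layer. The computational complexity (number of arithmetic operations) of the $K$-layer nested rebalancing algorithm $\mathrm{NERO}_K$, using the Vaidya method as LP solver, is $$O\left(\frac{N^{3.5}T^{2.5}L}{M^{3.5(K-1)}}\right)$$ with respect to the number $N$ of regions in the bottom layer, and is $$O\left(\frac{NM^{4.5}T^{2.5}L}{M-1}\right)$$ with respect to $M$.
   Context: Vaidya method: an LP solver which on a linear program with $m$ constraints and $n$ decision variables uses $C(m,n)=O(m^{1.5}nL)$ arithmetic operations, where $L$ is the bit size required to realize each operation. Optimal rebalancing problem with time-varying fleet size, on a finite set $\mathcal N$ of regions and time intervals $\mathcal T=[1,\dots,T]$. Given: travel times $\tau_{ij}\in\mathbb N$, travel costs $c_{ij}$, numbers of requests $\lambda_{ijt}$ from $i$ to $j$ departing at $t$, fleet sizes $V_t$ (with $V_0=0$). Unknowns: $x^p_{ijt}$ (vehicles transporting customers from $i$ to $j$ departing at $t$), $x^r_{ijt}$ (rebalancing vehicles from $i$ to $j$ departing at $t$), $x^a_{it}$ (empty vehicles arriving in $i$ from outside $\mathcal N$ at $t$), $x^d_{it}$ (vehicles departing from $i$ to outside $\mathcal N$ at $t$), $s_{i0}$ (initially available vehicles), all in $\mathbb N$; $x^r,x^p$ at nonpositive times are $0$. Minimize $\sum_{t,i,j}c_{ij}x^r_{ijt}$ subject to: $x^p_{ijt}=\lambda_{ijt}$; $\sum_{j}(x^r_{ijt}+x^p_{ijt}-x^r_{ji,t-\tau_{ji}}-x^p_{ji,t-\tau_{ji}})=s_{it}$,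 where $s_{i1}=s_{i0}$ and $s_{it}=x^a_{it}-x^d_{it}$ for $t>1$; $\sum_i\big(s_{it}+\sum_j\sum_{\Delta t=1}^{\tau_{ji}}(x^r_{ji,t-\Delta t}+x^p_{ji,t-\Delta t})\big)=V_t$; $\sum_i x^a_{it}=\max(V_t-V_{t-1},0)$; $\sum_i x^d_{it}=\max(V_{t-1}-V_t,0)$. The problem is solved by one call to an LP solver, and on $n_0$ regions it is counted as having $n_0T+2T$ constraints and $n_0^2T+2n_0T$ decision variables. $\mathrm{NERO}_K$: the whole area is organised in $K$ layers of regions (layer $1$ = top, coarsest; layer $K$ = bottom, finest). Each region $l$ of a layer above the bottom is segmented into a set $\mathcal N_l$ of regions of the next lower layer, its children; every such set has $M$ elements. The algorithm first solves the optimal rebalancing problem with time-varying fleet size on the set of all top-layer regions, with the externally given fleet sizes. Then, recursively down the layers, for each region $l$ above the bottom layer it solves the optimal rebalancing problem with time-varying fleet size on $\mathcal N_l$, using the customer demand within $\mathcal N_l$ and the fleet sizes $V_{lt}=s_{lt}+\sum_{j}(x^r_{jl,t-\tau_{jl}}+x^p_{jl,t-\tau_{jl}})$ computed from the already optimized policy on the set of regions containing $l$ (the sum is over that set; $s_{l1}=s_{l0}$ and $s_{lt}=x^a_{lt}-x^d_{lt}$ for $t>1$). The output is the collection of all the policies. The computational complexity is the total number of arithmetic operations of the LP solves. "With respect to $N$" (resp. "$M$") means as an asymptotic statement in $N$ (resp. in $M$), the other of the two and $K$ being fixed. *)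

theory Defs
  imports Complex_Main
begin

section \<open>Optimal rebalancing with time-varying fleet size\<close>

record 'r traffic =
  horizon :: nat
  travel_time :: "'r \<Rightarrow> 'r \<Rightarrow> nat"
  travel_cost :: "'r \<Rightarrow> 'r \<Rightarrow> real"
  demand :: "'r \<Rightarrow> 'r \<Rightarrow> nat \<Rightarrow> nat"

record 'r problem =
  traffic :: "'r traffic"
  regions :: "'r set"
  fleet :: "nat \<Rightarrow> int"

text \<open>
  The fields are the unknowns $x^p_{ijt}$, $x^r_{ijt}$, $x^a_{it}$, $x^d_{it}$, $s_{i0}$.
  Only the values for regions of the problem and for times in $1, \dots, T$ matter.
\<close>

record 'r policy =
  x_cust :: "'r \<Rightarrow> 'r \<Rightarrow> nat \<Rightarrow> nat"
  x_reb :: "'r \<Rightarrow> 'r \<Rightarrow> nat \<Rightarrow> nat"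
  x_arr :: "'r \<Rightarrow> nat \<Rightarrow> nat"
  x_dep :: "'r \<Rightarrow> nat \<Rightarrow> nat"
  s_init :: "'r \<Rightarrow> nat"

definition fleet_at :: "'r problem \<Rightarrow> nat \<Rightarrow> int" where
  "fleet_at P t = (if t = 0 then 0 else fleet P t)"

text \<open>
  All vehicles, rebalancing or with customers, that left \<open>i\<close> for \<open>j\<close> at time \<open>t - d\<close>;
  there are none at nonpositive times.
\<close>

definition sent :: "'r policy \<Rightarrow> 'r \<Rightarrow> 'r \<Rightarrow> nat \<Rightarrow> nat \<Rightarrow> int" where
  "sent x i j t d = (if d < t then int (x_reb x i j (t - d)) + int (x_cust x i j (t - d)) else 0)"

definition net_supply :: "'r policy \<Rightarrow> 'r \<Rightarrow> nat \<Rightarrow> int" where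
  "net_supply x i t = (if t = 1 then int (s_init x i) else int (x_arr x i t) - int (x_dep x i t))"

definition feasible :: "'r problem \<Rightarrow> 'r policy \<Rightarrow> bool" where
  "feasible P x \<longleftrightarrow>
    (let R = regions P; \<tau> = travel_time (traffic P) in
     \<forall>t\<in>{1..horizon (traffic P)}.
       (\<forall>i\<in>R. \<forall>j\<in>R. x_cust x i j t = demand (traffic P) i j t) \<and>
       (\<forall>i\<in>R. (\<Sum>j\<in>R. int (x_reb x i j t) + int (x_cust x i j t) - sent x j i t (\<tau> j i))
              = net_supply x i t) \<and>
       (\<Sum>i\<in>R. net_supply x i t + (\<Sum>j\<in>R. \<Sum>d = 1..\<tau> j i. sent x j i t d)) = fleet_at P t \<and>
       (\<Sum>i\<in>R. int (x_arr x i t)) = max (fleet_at P t - fleet_at P (t - 1)) 0 \<and>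
       (\<Sum>i\<in>R. int (x_dep x i t)) = max (fleet_at P (t - 1) - fleet_at P t) 0)"

definition rebalancing_cost :: "'r problem \<Rightarrow> 'r policy \<Rightarrow> real" where
  "rebalancing_cost P x =
    (\<Sum>t = 1..horizon (traffic P). \<Sum>i\<in>regions P. \<Sum>j\<in>regions P.
       travel_cost (traffic P) i j * real (x_reb x i j t))"

definition optimal :: "'r problem \<Rightarrow> 'r policy \<Rightarrow> bool" where
  "optimal P x \<longleftrightarrow>
    feasible P x \<and> (\<forall>y. feasible P y \<longrightarrow> rebalancing_cost P x \<le> rebalancing_cost P y)"

definition num_constraints :: "'r problem \<Rightarrow> nat" where
  "num_constraints P =
    card (regions P) * horizon (traffic P) + 2 * horizon (traffic P)"

definition num_variables :: "'r problem \<Rightarrow> nat" where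
  "num_variables P =
    (card (regions P))\<^sup>2 * horizon (traffic P) + 2 * card (regions P) * horizon (traffic P)"


section \<open>LP solvers\<close>

text \<open>
  \<open>op_count S m n L\<close> is the number of arithmetic operations, on operands of bit size \<open>L\<close>,
  that one call uses for \<open>m\<close> constraints and \<open>n\<close> decision variables.
\<close>

record 'r lp_solver =
  solve :: "'r problem \<Rightarrow> 'r policy"
  op_count :: "nat \<Rightarrow> nat \<Rightarrow> nat \<Rightarrow> nat"

definition vaidya_method :: "'r lp_solver \<Rightarrow> bool" where
  "vaidya_method S \<longleftrightarrow>
    (\<forall>P. finite (regions P) \<and> (\<exists>x. optimal P x) \<longrightarrow> optimal P (solve S P)) \<and>
    (\<exists>c::real. \<forall>m\<ge>1. \<forall>n\<ge>1. \<forall>L\<ge>1.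
       real (op_count S m n L) \<le> c * (real m powr 1.5 * real n * real L))"


section \<open>Nested rebalancing\<close>

text \<open>
  Regions of all layers live in one type, so the traffic data cover every layer;
  \<open>ext_fleet\<close> is the externally given fleet size.
\<close>

record 'r hierarchy =
  data :: "'r traffic"
  ext_fleet :: "nat \<Rightarrow> nat"
  layer :: "nat \<Rightarrow> 'r set"
  children :: "'r \<Rightarrow> 'r set"

definition layered :: "nat \<Rightarrow> nat \<Rightarrow> 'r hierarchy \<Rightarrow> bool" where
  "layered K M H \<longleftrightarrow>
    finite (layer H 1) \<and> layer H 1 \<noteq> {} \<and>
    (\<forall>k\<in>{1..K}. \<forall>k'\<in>{1..K}. k \<noteq> k' \<longrightarrow> layer H k \<inter> layer H k' = {}) \<and>
    (\<forall>k\<in>{1..<K}.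
       (\<forall>l\<in>layer H k. finite (children H l) \<and> card (children H l) = M) \<and>
       (\<forall>l\<in>layer H k. \<forall>l'\<in>layer H k. l \<noteq> l' \<longrightarrow> children H l \<inter> children H l' = {}) \<and>
       layer H (Suc k) = (\<Union>l\<in>layer H k. children H l))"

definition child_fleet :: "'r problem \<Rightarrow> 'r policy \<Rightarrow> 'r \<Rightarrow> nat \<Rightarrow> int" where
  "child_fleet P x l t =
    net_supply x l t + (\<Sum>j\<in>regions P. sent x j l t (travel_time (traffic P) j l))"

text \<open>
  \<open>nero_rec S L H d A V\<close> rebalances the fleet \<open>V\<close> on the set \<open>A\<close> of regions and then inside
  each of them, where \<open>d\<close> is the number of layers from that of \<open>A\<close> down to the bottom.
  It returns the policies, each with the set of regions it is for, and the number of
  arithmetic operations.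
\<close>

primrec nero_rec ::
  "'r lp_solver \<Rightarrow> nat \<Rightarrow> 'r hierarchy \<Rightarrow> nat \<Rightarrow> 'r set \<Rightarrow> (nat \<Rightarrow> int) \<Rightarrow>
    ('r set \<times> 'r policy) set \<times> nat"
where
  "nero_rec S L H 0 A V = ({}, 0)"
| "nero_rec S L H (Suc d) A V =
    (let P = \<lparr>traffic = data H, regions = A, fleet = V\<rparr>;
         x = solve S P;
         sub = (\<lambda>l. nero_rec S L H d (children H l) (child_fleet P x l))
     in (insert (A, x) (\<Union>l\<in>A. fst (sub l)),
         op_count S (num_constraints P) (num_variables P) L + (\<Sum>l\<in>A. snd (sub l))))"

definition nero ::
  "'r lp_solver \<Rightarrow> nat \<Rightarrow> nat \<Rightarrow> 'r hierarchy \<Rightarrow> ('r set \<times> 'r policy) set \<times> nat" where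
  "nero S K L H = nero_rec S L H K (layer H 1) (\<lambda>t. int (ext_fleet H t))"

definition nero_ops :: "'r lp_solver \<Rightarrow> nat \<Rightarrow> nat \<Rightarrow> 'r hierarchy \<Rightarrow> nat" where
  "nero_ops S K L H = snd (nero S K L H)"

end

theory Submission imports Defs begin

text \<open>
  On \<open>n\<close> regions the problem has at most \<open>3nT\<close> constraints and \<open>3n\<^sup>2T\<close> variables, so with the Vaidya
  method it costs at most \<open>C n powr 3.5\<close>, where \<open>C\<close> is proportional to \<open>T powr 2.5 * L\<close>
  (\<open>vaidya_rebalancing_ops\<close>).  The algorithm solves one problem on the \<open>n\<^sub>1\<close> top-layer regions and, for
  each of the \<open>n\<^sub>1 M\<^sup>i\<close> regions \<open>i\<close> layers below the top and above the bottom layer, one on its \<open>M\<close>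
  children.  The total is therefore at most
  \<open>C (n\<^sub>1 powr 3.5 + n\<^sub>1 M powr 3.5 (1 + M + \<dots> + M\<^sup>K\<^sup>-\<^sup>2))\<close> (\<open>nero_ops_le\<close>), whatever fleet sizes the
  solver hands down.  Since the bottom layer has \<open>N = n\<^sub>1 M\<^sup>K\<^sup>-\<^sup>1\<close> regions (\<open>card_bottom_layer\<close>), both
  bounds can be read off this total.

  For \<open>M\<close> and \<open>K\<close> fixed, the geometric sum is a constant and \<open>n\<^sub>1 \<le> n\<^sub>1 powr 3.5\<close>, so the top layer
  dominates: the order is \<open>n\<^sub>1 powr 3.5 = N powr 3.5 / M powr (3.5 (K - 1))\<close>.

  For \<open>N\<close> and \<open>K\<close> fixed, the geometric sum gives
  \<open>n\<^sub>1 (1 + \<dots> + M\<^sup>K\<^sup>-\<^sup>2) = (N - n\<^sub>1) / (M - 1) \<le> N / (M - 1)\<close>.  Thus, up to the factor \<open>C\<close>, the lower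
  layers cost at most \<open>N M powr 3.5 / (M - 1)\<close>.  The top layer costs at most \<open>N powr 3.5\<close>, which is at
  most \<open>N powr 2.5\<close> times \<open>N M powr 4.5 / (M - 1)\<close>, because \<open>M powr 4.5 / (M - 1) \<ge> 1\<close>; the factor
  \<open>N powr 2.5\<close> is a constant here.
\<close>

section \<open>Cost of one rebalancing problem\<close>

text \<open>
  The exponents come from \<open>(nT) powr 1.5 * (n\<^sup>2T) = n powr 3.5 * T powr 2.5\<close>.  Regions and time
  intervals must be present, since the terms \<open>2T\<close> and \<open>2nT\<close> are absorbed by \<open>nT\<close> and \<open>n\<^sup>2T\<close>.
\<close>

lemma vaidya_rebalancing_ops:
  fixes S :: "'r lp_solver"
  assumes "vaidya_method S"
  obtains c :: real where "c \<ge> 0"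
    and "\<And>(P :: 'r problem) L. \<lbrakk>card (regions P) \<ge> 1; horizon (traffic P) \<ge> 1; L \<ge> 1\<rbrakk> \<Longrightarrow>
      real (op_count S (num_constraints P) (num_variables P) L)
        \<le> c * (real (card (regions P)) powr 3.5 * real (horizon (traffic P)) powr 2.5 * real L)"
proof -
  obtain c :: real where c: "\<And>m n L. \<lbrakk>m \<ge> 1; n \<ge> 1; L \<ge> 1\<rbrakk> \<Longrightarrow>
      real (op_count S m n L) \<le> c * (real m powr 1.5 * real n * real L)"
    using assms unfolding vaidya_method_def by blast
  have c0: "c \<ge> 0"
    using c[of 1 1 1] by simp
  have bound: "real (op_count S (num_constraints P) (num_variables P) L)
      \<le> (c * 3 powr 2.5) *
          (real (card (regions P)) powr 3.5 * real (horizon (traffic P)) powr 2.5 * real L)"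
    if n1: "card (regions P) \<ge> 1" and T1: "horizon (traffic P) \<ge> 1" and L1: "L \<ge> 1"
    for P :: "'r problem" and L
  proof -
    define n where "n = card (regions P)"
    define T where "T = horizon (traffic P)"
    have pos: "n \<ge> 1" "T \<ge> 1"
      using n1 T1 by (auto simp: n_def T_def)
    have "T \<le> n * T" "n * T \<le> n\<^sup>2 * T"
      using pos by (auto simp: power2_eq_square)
    then have "num_constraints P \<le> 3 * (n * T)" "num_variables P \<le> 3 * (n\<^sup>2 * T)"
      unfolding num_constraints_def num_variables_def n_def T_def by linarith+
    from this[THEN of_nat_mono, where 'a = real]
    have m_le: "real (num_constraints P) \<le> 3 * real n * real T"
      and v_le: "real (num_variables P) \<le> 3 * (real n)\<^sup>2 * real T"
      by (simp_all add: mult.assoc)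
    have ge1: "num_constraints P \<ge> 1" "num_variables P \<ge> 1"
      using n1 T1 by (auto simp: num_constraints_def num_variables_def Suc_le_eq)
    have "real (num_constraints P) powr 1.5 * real (num_variables P)
        \<le> (3 * real n * real T) powr 1.5 * (3 * (real n)\<^sup>2 * real T)"
      by (intro mult_mono powr_mono2 m_le v_le) auto
    also have "\<dots> = (3 powr 1.5 * 3 powr 1) * (real n powr 1.5 * real n powr 2)
        * (real T powr 1.5 * real T powr 1)"
      using pos by (simp add: powr_mult powr_numeral)
    also have "\<dots> = 3 powr 2.5 * real n powr 3.5 * real T powr 2.5"
      unfolding powr_add[symmetric] by simp
    finally have "c * (real (num_constraints P) powr 1.5 * real (num_variables P) * real L)
        \<le> c * (3 powr 2.5 * real n powr 3.5 * real T powr 2.5 * real L)"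
      by (intro mult_left_mono mult_right_mono c0) auto
    then show ?thesis
      using c[OF ge1 L1] by (simp add: n_def T_def mult_ac)
  qed
  show thesis
    by (rule that[of "c * 3 powr 2.5", OF _ bound]) (use c0 in auto)
qed

section \<open>Sizes of the layers\<close>

lemma layered_children:
  assumes "layered K M H" "k \<ge> 1" "k < K" "l \<in> layer H k"
  shows "finite (children H l)" "card (children H l) = M" "children H l \<subseteq> layer H (Suc k)"
proof -
  have k: "k \<in> {1..<K}"
    using assms(2,3) by simp
  show "finite (children H l)" "card (children H l) = M"
    using assms(1,4) k unfolding layered_def by blast+
  have "layer H (Suc k) = (\<Union>l\<in>layer H k. children H l)"
    using assms(1) k unfolding layered_def by blast
  then show "children H l \<subseteq> layer H (Suc k)"
    using assms(4) by blast
qed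

lemma card_layer:
  assumes "layered K M H" "i < K"
  shows "finite (layer H (Suc i)) \<and> card (layer H (Suc i)) = card (layer H 1) * M ^ i"
  using assms(2)
proof (induction i)
  case 0
  then show ?case
    using assms(1) by (simp add: layered_def)
next
  case (Suc i)
  then have IH: "finite (layer H (Suc i))" "card (layer H (Suc i)) = card (layer H 1) * M ^ i"
    by auto
  have k: "Suc i \<in> {1..<K}"
    using Suc.prems by simp
  have union: "layer H (Suc (Suc i)) = (\<Union>l\<in>layer H (Suc i). children H l)"
    and disj: "\<forall>l\<in>layer H (Suc i). \<forall>l'\<in>layer H (Suc i).
      l \<noteq> l' \<longrightarrow> children H l \<inter> children H l' = {}"
    using assms(1) k unfolding layered_def by blast+
  have ch: "finite (children H l)" "card (children H l) = M" if "l \<in> layer H (Suc i)" for l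
    using layered_children[OF assms(1) _ _ that] Suc.prems by auto
  have "card (layer H (Suc (Suc i))) = (\<Sum>l\<in>layer H (Suc i). card (children H l))"
    unfolding union using IH(1) ch disj by (intro card_UN_disjoint) auto
  also have "\<dots> = card (layer H (Suc i)) * M"
    using ch by simp
  finally show ?case
    using IH ch union by simp
qed

lemma card_bottom_layer:
  assumes "layered K M H" "K \<ge> 1"
  shows "card (layer H K) = card (layer H 1) * M ^ (K - 1)"
  using card_layer[OF assms(1), of "K - 1"] assms(2) by simp

lemma card_top_layer_ge_1:
  assumes "layered K M H"
  shows "card (layer H 1) \<ge> 1"
  using assms by (simp add: layered_def Suc_le_eq card_gt_0_iff)

section \<open>Total cost of the recursion\<close>

text \<open>
  The fleets of the subproblems come from the policies that the solver returns, so the cost estimate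
  \<open>op\<close> and the induction hypothesis have to hold for every fleet.  Each region of \<open>A\<close> contributes a
  subproblem with \<open>M\<close> regions, and the recursion of the bound is the Horner step
  \<open>1 + M (1 + \<dots> + M\<^sup>d\<^sup>-\<^sup>1) = 1 + \<dots> + M\<^sup>d\<close>.
\<close>

lemma nero_rec_ops_le:
  fixes S :: "'r lp_solver" and C :: real
  assumes op: "\<And>A V. \<lbrakk>finite A; A \<noteq> {}\<rbrakk> \<Longrightarrow>
      (let P = \<lparr>traffic = data H, regions = A, fleet = V\<rparr> in
        real (op_count S (num_constraints P) (num_variables P) L)) \<le> C * real (card A) powr 3.5"
    and H: "layered K M H" and M: "M \<ge> 1"
    and A: "finite A" "A \<noteq> {}" "A \<subseteq> layer H k" and k: "k \<ge> 1" "k + d = K"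
  shows "real (snd (nero_rec S L H (Suc d) A V))
      \<le> C * (real (card A) powr 3.5 + real (card A) * real M powr 3.5 * (\<Sum>i<d. real M ^ i))"
  using A k
proof (induction d arbitrary: A V k)
  case 0
  then show ?case
    using op[of A V] by (simp add: Let_def)
next
  case (Suc d)
  let ?P = "\<lparr>traffic = data H, regions = A, fleet = V\<rparr>"
  let ?sub = "\<lambda>l. nero_rec S L H (Suc d) (children H l) (child_fleet ?P (solve S ?P) l)"
  let ?G = "\<Sum>i<d. real M ^ i"
  have sub: "real (snd (?sub l)) \<le> C * (real M powr 3.5 + real M * real M powr 3.5 * ?G)"
    if "l \<in> A" for l
  proof -
    have "l \<in> layer H k" "k < K"
      using that Suc.prems by auto
    note ch = layered_children[OF H Suc.prems(4) this(2,1)]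
    have "children H l \<noteq> {}"
      using ch(2) M by auto
    with Suc.IH[OF ch(1) this ch(3)] ch(2) Suc.prems(5) show ?thesis
      by simp
  qed
  have "real (snd (nero_rec S L H (Suc (Suc d)) A V))
      = real (op_count S (num_constraints ?P) (num_variables ?P) L)
        + (\<Sum>l\<in>A. real (snd (?sub l)))"
    by (subst nero_rec.simps(2)) (simp add: Let_def del: nero_rec.simps)
  also have "\<dots> \<le> C * real (card A) powr 3.5
      + (\<Sum>l\<in>A. C * (real M powr 3.5 + real M * real M powr 3.5 * ?G))"
    using op[OF Suc.prems(1,2), of V] by (intro add_mono sum_mono sub) (simp_all add: Let_def)
  also have "\<dots> = C * (real (card A) powr 3.5
      + real (card A) * real M powr 3.5 * (1 + real M * ?G))"
    by (simp add: algebra_simps)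
  also have "1 + real M * ?G = (\<Sum>i<Suc d. real M ^ i)"
    by (simp add: sum.lessThan_Suc_shift sum_distrib_left del: sum.lessThan_Suc)
  finally show ?case .
qed

lemma nero_ops_le:
  fixes S :: "'r lp_solver"
  assumes "vaidya_method S"
  obtains c :: real where "c \<ge> 0"
    and "\<And>K M L (H :: 'r hierarchy).
      \<lbrakk>layered K M H; K \<ge> 1; M \<ge> 1; L \<ge> 1; horizon (data H) \<ge> 1\<rbrakk> \<Longrightarrow>
      real (nero_ops S K L H)
        \<le> c * (real (horizon (data H)) powr 2.5 * real L) *
          (real (card (layer H 1)) powr 3.5
            + real (card (layer H 1)) * real M powr 3.5 * (\<Sum>i<K - 1. real M ^ i))"
proof -
  obtain c :: real where c: "c \<ge> 0"
    and op: "\<And>(P :: 'r problem) L. \<lbrakk>card (regions P) \<ge> 1; horizon (traffic P) \<ge> 1; L \<ge> 1\<rbrakk> \<Longrightarrow>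
      real (op_count S (num_constraints P) (num_variables P) L)
        \<le> c * (real (card (regions P)) powr 3.5 * real (horizon (traffic P)) powr 2.5 * real L)"
    using vaidya_rebalancing_ops[OF assms] by blast
  have total: "real (nero_ops S K L H)
      \<le> c * (real (horizon (data H)) powr 2.5 * real L) *
        (real (card (layer H 1)) powr 3.5
          + real (card (layer H 1)) * real M powr 3.5 * (\<Sum>i<K - 1. real M ^ i))"
    if H: "layered K M H" and K: "K \<ge> 1" and M: "M \<ge> 1" and L: "L \<ge> 1"
      and T: "horizon (data H) \<ge> 1"
    for K M L and H :: "'r hierarchy"
  proof -
    let ?V = "\<lambda>t. int (ext_fleet H t)"
    have "real (snd (nero_rec S L H (Suc (K - 1)) (layer H 1) ?V))
        \<le> c * (real (horizon (data H)) powr 2.5 * real L) *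
          (real (card (layer H 1)) powr 3.5
            + real (card (layer H 1)) * real M powr 3.5 * (\<Sum>i<K - 1. real M ^ i))"
    proof (rule nero_rec_ops_le[OF _ H M, where k = 1])
      fix A :: "'r set" and V :: "nat \<Rightarrow> int"
      assume "finite A" "A \<noteq> {}"
      then have "card A \<ge> 1"
        by (simp add: Suc_le_eq card_gt_0_iff)
      then show "(let P = \<lparr>traffic = data H, regions = A, fleet = V\<rparr> in
          real (op_count S (num_constraints P) (num_variables P) L))
          \<le> c * (real (horizon (data H)) powr 2.5 * real L) * real (card A) powr 3.5"
        using op[of "\<lparr>traffic = data H, regions = A, fleet = V\<rparr>" L] T L
        by (simp add: Let_def mult_ac)
    next
      show "finite (layer H 1)" "layer H 1 \<noteq> {}"
        using H by (auto simp: layered_def)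
    qed (use K in auto)
    then show ?thesis
      using K by (simp add: nero_ops_def nero_def del: nero_rec.simps)
  qed
  show thesis
    by (rule that[OF c total])
qed

section \<open>The total in terms of the bottom layer\<close>

text \<open>
  The bound of \<open>nero_ops_le\<close> for \<open>n\<close> top-layer regions and \<open>K = q + 1\<close> layers, so that \<open>n M\<^sup>q\<close> is the
  number of bottom-layer regions.  For fixed \<open>M\<close> and \<open>q\<close> the top-layer problem has the dominant order.
\<close>

lemma total_le_in_N:
  fixes n M q :: nat
  assumes "n \<ge> 1" "M \<ge> 1"
  shows "real n powr 3.5 + real n * real M powr 3.5 * (\<Sum>i<q. real M ^ i)
    \<le> (1 + real M powr 3.5 * (\<Sum>i<q. real M ^ i))
        * (real (n * M ^ q) powr 3.5 / real M powr (3.5 * real q))"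
proof -
  have "real (n * M ^ q) powr 3.5 = real n powr 3.5 * real M powr (3.5 * real q)"
    using assms by (simp add: powr_mult powr_powr mult.commute flip: powr_realpow)
  then have top: "real (n * M ^ q) powr 3.5 / real M powr (3.5 * real q) = real n powr 3.5"
    using assms by simp
  have "real n powr 1 \<le> real n powr 3.5"
    using assms by (intro powr_mono) auto
  then have "real n * (real M powr 3.5 * (\<Sum>i<q. real M ^ i))
      \<le> real n powr 3.5 * (real M powr 3.5 * (\<Sum>i<q. real M ^ i))"
    using assms by (intro mult_right_mono mult_nonneg_nonneg sum_nonneg) auto
  then show ?thesis
    unfolding top by (simp add: algebra_simps)
qed

text \<open>
  Here \<open>M\<close> varies while the number of bottom-layer regions is fixed, so the factor in front of the
  bound may depend on \<open>n M\<^sup>q\<close>: its first summand pays for the top layer, its second for the others.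
\<close>

lemma total_le_in_M:
  fixes n M q :: nat
  assumes "M \<ge> 2"
  shows "real n powr 3.5 + real n * real M powr 3.5 * (\<Sum>i<q. real M ^ i)
    \<le> (real (n * M ^ q) powr 2.5 + 1)
        * (real (n * M ^ q) * real M powr 4.5 / (real M - 1))"
proof -
  define N where "N = n * M ^ q"
  define b where "b = real M powr 4.5 / (real M - 1)"
  have M1: "real M - 1 > 0"
    using assms by simp
  have "real M powr 1 \<le> real M powr 4.5"
    using assms by (intro powr_mono) auto
  then have b1: "b \<ge> 1"
    using M1 assms by (simp add: b_def)
  have "n \<le> N"
    using assms by (simp add: N_def)
  then have "real n powr 3.5 \<le> real N powr 3.5"
    by (intro powr_mono2) auto
  also have "\<dots> = real N powr 2.5 * real N"
    using powr_add[of "real N" "2.5" 1] by simp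
  also have "\<dots> \<le> real N powr 2.5 * real N * b"
    using mult_left_mono[OF b1, of "real N powr 2.5 * real N"] by simp
  finally have top: "real n powr 3.5 \<le> real N powr 2.5 * real N * b" .
  have "real n * (\<Sum>i<q. real M ^ i) = (real N - real n) / (real M - 1)"
    using assms by (simp add: geometric_sum N_def right_diff_distrib)
  also have "\<dots> \<le> real N / (real M - 1)"
    using M1 by (intro divide_right_mono) auto
  finally have "real M powr 3.5 * (real n * (\<Sum>i<q. real M ^ i))
      \<le> real M powr 4.5 * (real N / (real M - 1))"
    using assms by (intro mult_mono powr_mono mult_nonneg_nonneg sum_nonneg) auto
  then have "real n * real M powr 3.5 * (\<Sum>i<q. real M ^ i) \<le> real N * b"
    by (simp add: b_def mult_ac)
  with top have "real n powr 3.5 + real n * real M powr 3.5 * (\<Sum>i<q. real M ^ i)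
      \<le> (real N powr 2.5 + 1) * (real N * b)"
    by (simp add: algebra_simps)
  then show ?thesis
    by (simp add: N_def b_def)
qed

theorem corollary4:
  fixes S :: "'r lp_solver"
  assumes "vaidya_method S"
  shows
    "(\<forall>K\<ge>1. \<forall>M\<ge>1. \<exists>c::real. \<forall>N T L. \<forall>H :: 'r hierarchy.
        layered K M H \<and> card (layer H K) = N \<and> horizon (data H) = T \<and> 1 \<le> T \<and> 1 \<le> L \<longrightarrow>
        real (nero_ops S K L H)
          \<le> c * (real N powr 3.5 * real T powr 2.5 * real L
                 / real M powr (3.5 * (real K - 1)))) \<and>
     (\<forall>K\<ge>1. \<forall>N. \<exists>c::real. \<forall>M\<ge>2. \<forall>T L. \<forall>H :: 'r hierarchy.
        layered K M H \<and> card (layer H K) = N \<and> horizon (data H) = T \<and> 1 \<le> T \<and> 1 \<le> L \<longrightarrow>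
        real (nero_ops S K L H)
          \<le> c * (real N * real M powr 4.5 * real T powr 2.5 * real L / (real M - 1)))"
proof -
  obtain c :: real where c: "c \<ge> 0"
    and ops: "\<And>K M L (H :: 'r hierarchy).
      \<lbrakk>layered K M H; K \<ge> 1; M \<ge> 1; L \<ge> 1; horizon (data H) \<ge> 1\<rbrakk> \<Longrightarrow>
      real (nero_ops S K L H)
        \<le> c * (real (horizon (data H)) powr 2.5 * real L) *
          (real (card (layer H 1)) powr 3.5
            + real (card (layer H 1)) * real M powr 3.5 * (\<Sum>i<K - 1. real M ^ i))"
    using nero_ops_le[OF assms] by blast
  have ops_le: "real (nero_ops S K L H) \<le> c * (real (horizon (data H)) powr 2.5 * real L) * b"
    if "layered K M H" "K \<ge> 1" "M \<ge> 1" "L \<ge> 1" "horizon (data H) \<ge> 1"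
      and "real (card (layer H 1)) powr 3.5
            + real (card (layer H 1)) * real M powr 3.5 * (\<Sum>i<K - 1. real M ^ i) \<le> b"
    for K M L and H :: "'r hierarchy" and b
    using order_trans[OF ops[OF that(1-5)] mult_left_mono[OF that(6)]] c by simp
  show ?thesis
  proof (intro conjI allI impI)
    fix K M :: nat
    assume K: "1 \<le> K" and M: "1 \<le> M"
    define g where "g = 1 + real M powr 3.5 * (\<Sum>i<K - 1. real M ^ i)"
    show "\<exists>c::real. \<forall>N T L. \<forall>H :: 'r hierarchy.
        layered K M H \<and> card (layer H K) = N \<and> horizon (data H) = T \<and> 1 \<le> T \<and> 1 \<le> L \<longrightarrow>
        real (nero_ops S K L H)
          \<le> c * (real N powr 3.5 * real T powr 2.5 * real L
                 / real M powr (3.5 * (real K - 1)))"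
    proof (intro exI[of _ "c * g"] allI impI, elim conjE)
      fix N T L :: nat and H :: "'r hierarchy"
      assume H: "layered K M H" and N: "card (layer H K) = N" and T: "horizon (data H) = T"
        and T1: "1 \<le> T" and L1: "1 \<le> L"
      note ge1 = K M L1 T1[folded T]
      have "real (nero_ops S K L H) \<le> c * (real T powr 2.5 * real L)
          * (g * (real N powr 3.5 / real M powr (3.5 * (real K - 1))))"
        using ops_le[OF H ge1 total_le_in_N[OF card_top_layer_ge_1[OF H] M]]
          card_bottom_layer[OF H K] N T K by (simp add: g_def of_nat_diff)
      then show "real (nero_ops S K L H) \<le> c * g *
          (real N powr 3.5 * real T powr 2.5 * real L / real M powr (3.5 * (real K - 1)))"
        by (simp add: mult_ac)
    qed
  next
    fix K N :: nat
    assume K: "1 \<le> K"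
    show "\<exists>c::real. \<forall>M\<ge>2. \<forall>T L. \<forall>H :: 'r hierarchy.
        layered K M H \<and> card (layer H K) = N \<and> horizon (data H) = T \<and> 1 \<le> T \<and> 1 \<le> L \<longrightarrow>
        real (nero_ops S K L H)
          \<le> c * (real N * real M powr 4.5 * real T powr 2.5 * real L / (real M - 1))"
    proof (intro exI[of _ "c * (real N powr 2.5 + 1)"] allI impI, elim conjE)
      fix M T L :: nat and H :: "'r hierarchy"
      assume M: "2 \<le> M" and H: "layered K M H" and N: "card (layer H K) = N"
        and T: "horizon (data H) = T" and T1: "1 \<le> T" and L1: "1 \<le> L"
      have M1: "1 \<le> M"
        using M by simp
      note ge1 = K M1 L1 T1[folded T]
      have "real (nero_ops S K L H) \<le> c * (real T powr 2.5 * real L)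
          * ((real N powr 2.5 + 1) * (real N * real M powr 4.5 / (real M - 1)))"
        using ops_le[OF H ge1 total_le_in_M[OF M]] card_bottom_layer[OF H K] N T by simp
      then show "real (nero_ops S K L H) \<le> c * (real N powr 2.5 + 1) *
          (real N * real M powr 4.5 * real T powr 2.5 * real L / (real M - 1))"
        by (simp add: mult_ac)
    qed
  qed
qed

end
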